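(* Let $G$ be a locally compact abelian group with neutral element $e$ and with character group $\widehat{G}$ (whose neutral element is also denoted $e$). Let $d$ be a metric on $G$ and $\widehat{d}$ a metric on $\widehat{G}$, both continuous, invariant and proper, and both of homogeneous polynomial growth of the same order $t$; that is, there are constants $t, A, \widehat{A} > 0$ such that \[ \forall r > 0: \quad |B_r(e)| \le A r^t , \qquad |\widehat{B}_r(e)| \le \widehat{A} r^t . \] Then every $f \in L^2(G)$ satisfies \[ \inf_{a \in G,\, b \in \widehat{G}} \left( \int_G d(x,a)^2 |f(x)|^2 \, dx \int_{\widehat{G}} \widehat{d}(\xi,b)^2 |\widehat{f}(\xi)|^2 \, d\xi \right) \ge C_G \|f\|_2^4 , \] where \[ C_G = \frac{\alpha_t}{A^{2/t} \widehat{A}^{2/t}}, \qquad \alpha_t = \max_{\delta \in (0,1/2)} (1-2\delta)^{4/t} (2\delta - \delta^2)^4 . \]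
   Context: Groups are written multiplicatively. $dx$ and $d\xi$ denote Haar measures on $G$ and $\widehat{G}$, and $|\cdot|$ denotes the Haar measure of a Borel subset of $G$ or of $\widehat{G}$. $\widehat{f}$ denotes the Plancherel transform of $f \in L^2(G)$, and the Haar measures are normalized so that $\|f\|_2 = \|\widehat{f}\|_2$ for all $f \in L^2(G)$. Open balls are $B_r(x) = \{ y \in G : d(x,y) < r\}$ and $\widehat{B}_r(\xi) = \{ \eta \in \widehat{G} : \widehat{d}(\xi,\eta) < r \}$. A metric $d$ on $G$ is invariant if $d(xy,xz) = d(y,z)$ for all $x,y,z \in G$; it is proper if for every $r>0$ the open ball $B_r(e)$ is relatively compact; continuity means that $d: G \times G \to \mathbb{R}$ is continuous with respect to the given group topology. The same terms are used for $\widehat{d}$ on $\widehat{G}$. *)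

theory Defs
  imports "HOL-Analysis.Analysis" "HOL-Algebra.Group"
begin

locale lca_group = comm_group G for G (structure) +
  fixes T :: "'a topology"
  assumes topspace_eq_carrier: "topspace T = carrier G"
    and continuous_mult: "continuous_map (prod_topology T T) T (\<lambda>(x, y). x \<otimes> y)"
    and continuous_inv: "continuous_map T T (\<lambda>x. inv x)"
    and Hausdorff: "Hausdorff_space T"
    and locally_compact: "locally_compact_space T"

definition circle_group :: "complex monoid" where
  "circle_group = \<lparr>carrier = sphere 0 1, mult = (*), one = 1\<rparr>"

(* Characters are taken extensional (undefined off the carrier), so that two
   characters agreeing on the group are equal as elements of the dual. *)
definition dual_group :: "('a, 'm) monoid_scheme \<Rightarrow> 'a topology \<Rightarrow> ('a \<Rightarrow> complex) monoid" where
  "dual_group G T =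
     \<lparr>carrier = {\<xi> \<in> hom G circle_group. continuous_map T euclidean \<xi> \<and> \<xi> \<in> extensional (carrier G)},
      mult = (\<lambda>\<xi> \<eta>. \<lambda>x\<in>carrier G. \<xi> x * \<eta> x),
      one = (\<lambda>x\<in>carrier G. 1)\<rparr>"

(* The compact-open topology. *)
definition dual_topology :: "('a, 'm) monoid_scheme \<Rightarrow> 'a topology \<Rightarrow> ('a \<Rightarrow> complex) topology" where
  "dual_topology G T =
     topology_generated_by
       {{\<xi> \<in> carrier (dual_group G T). \<xi> ` K \<subseteq> U} | K U. compactin T K \<and> open U}"

(* A nonzero translation-invariant Radon measure on the Borel sets of T. *)
definition haar_measure :: "('a, 'm) monoid_scheme \<Rightarrow> 'a topology \<Rightarrow> 'a measure \<Rightarrow> bool" where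
  "haar_measure G T M \<longleftrightarrow>
     space M = topspace T \<and>
     sets M = sigma_sets (topspace T) {U. openin T U} \<and>
     emeasure M (space M) \<noteq> 0 \<and>
     (\<forall>K. compactin T K \<longrightarrow> emeasure M K < \<infinity>) \<and>
     (\<forall>B \<in> sets M. emeasure M B = (INF U\<in>{U. openin T U \<and> B \<subseteq> U}. emeasure M U)) \<and>
     (\<forall>U. openin T U \<longrightarrow> emeasure M U = (SUP K\<in>{K. compactin T K \<and> K \<subseteq> U}. emeasure M K)) \<and>
     (\<forall>x \<in> carrier G. \<forall>B \<in> sets M. emeasure M ((\<lambda>y. x \<otimes>\<^bsub>G\<^esub> y) ` B) = emeasure M B)"

definition L2 :: "'a measure \<Rightarrow> ('a \<Rightarrow> complex) set" where
  "L2 M = {f \<in> borel_measurable M. integrable M (\<lambda>x. (norm (f x))\<^sup>2)}"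

definition L2_norm :: "'a measure \<Rightarrow> ('a \<Rightarrow> complex) \<Rightarrow> real" where
  "L2_norm M f = sqrt (LINT x|M. (norm (f x))\<^sup>2)"

definition L2_tendsto :: "'a measure \<Rightarrow> (nat \<Rightarrow> 'a \<Rightarrow> complex) \<Rightarrow> ('a \<Rightarrow> complex) \<Rightarrow> bool" where
  "L2_tendsto M h f \<longleftrightarrow> (\<lambda>n. \<integral>\<^sup>+x. ennreal ((norm (h n x - f x))\<^sup>2) \<partial>M) \<longlonglongrightarrow> 0"

definition fourier :: "'a measure \<Rightarrow> ('a \<Rightarrow> complex) \<Rightarrow> ('a \<Rightarrow> complex) \<Rightarrow> complex" where
  "fourier M f \<xi> = (LINT x|M. f x * cnj (\<xi> x))"

(* M and N are Haar measures on a group and on its dual. On functions that are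
   both integrable and square-integrable the Plancherel transform is the Fourier
   integral; otherwise it is the L2-limit of Fourier integrals of L2-approximants
   of that kind. The limit is determined only up to N-null sets, hence SOME. *)
definition plancherel ::
    "'a measure \<Rightarrow> ('a \<Rightarrow> complex) measure \<Rightarrow> ('a \<Rightarrow> complex) \<Rightarrow> ('a \<Rightarrow> complex) \<Rightarrow> complex" where
  "plancherel M N f =
     (if integrable M f then fourier M f
      else SOME g. g \<in> L2 N \<and>
        (\<exists>h. (\<forall>n. h n \<in> L2 M \<and> integrable M (h n)) \<and>
             L2_tendsto M h f \<and> L2_tendsto N (\<lambda>n. fourier M (h n)) g))"

definition plancherel_normalized :: "'a measure \<Rightarrow> ('a \<Rightarrow> complex) measure \<Rightarrow> bool" where
  "plancherel_normalized M N \<longleftrightarrow>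
     (\<forall>f \<in> L2 M. plancherel M N f \<in> L2 N \<and> L2_norm M f = L2_norm N (plancherel M N f))"

definition continuous_metric :: "('a, 'm) monoid_scheme \<Rightarrow> 'a topology \<Rightarrow> ('a \<Rightarrow> 'a \<Rightarrow> real) \<Rightarrow> bool" where
  "continuous_metric G T d \<longleftrightarrow>
     Metric_space (carrier G) d \<and>
     continuous_map (prod_topology T T) euclidean (\<lambda>(x, y). d x y)"

definition invariant_metric :: "('a, 'm) monoid_scheme \<Rightarrow> ('a \<Rightarrow> 'a \<Rightarrow> real) \<Rightarrow> bool" where
  "invariant_metric G d \<longleftrightarrow>
     (\<forall>x \<in> carrier G. \<forall>y \<in> carrier G. \<forall>z \<in> carrier G.
        d (x \<otimes>\<^bsub>G\<^esub> y) (x \<otimes>\<^bsub>G\<^esub> z) = d y z)"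

abbreviation group_ball :: "('a, 'm) monoid_scheme \<Rightarrow> ('a \<Rightarrow> 'a \<Rightarrow> real) \<Rightarrow> 'a \<Rightarrow> real \<Rightarrow> 'a set" where
  "group_ball G d \<equiv> Metric_space.mball (carrier G) d"

definition proper_metric :: "('a, 'm) monoid_scheme \<Rightarrow> 'a topology \<Rightarrow> ('a \<Rightarrow> 'a \<Rightarrow> real) \<Rightarrow> bool" where
  "proper_metric G T d \<longleftrightarrow>
     (\<forall>r>0. compactin T (T closure_of (group_ball G d \<one>\<^bsub>G\<^esub> r)))"

definition polynomial_growth ::
    "('a, 'm) monoid_scheme \<Rightarrow> 'a measure \<Rightarrow> ('a \<Rightarrow> 'a \<Rightarrow> real) \<Rightarrow> real \<Rightarrow> real \<Rightarrow> bool" where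
  "polynomial_growth G M d t A \<longleftrightarrow>
     (\<forall>r>0. emeasure M (group_ball G d \<one>\<^bsub>G\<^esub> r) \<le> ennreal (A * r powr t))"

definition dispersion :: "'a measure \<Rightarrow> ('a \<Rightarrow> 'a \<Rightarrow> real) \<Rightarrow> 'a \<Rightarrow> ('a \<Rightarrow> complex) \<Rightarrow> ennreal" where
  "dispersion M d a f = (\<integral>\<^sup>+x. ennreal ((d x a)\<^sup>2 * (norm (f x))\<^sup>2) \<partial>M)"

(* GREATEST is the maximum over the open interval; it is attained because the
   function is continuous on [0, 1/2], positive inside and 0 at both ends. *)
definition alpha :: "real \<Rightarrow> real" where
  "alpha t = (GREATEST y. y \<in> (\<lambda>\<delta>. (1 - 2 * \<delta>) powr (4 / t) * (2 * \<delta> - \<delta>\<^sup>2) ^ 4) ` {0<..<1/2})"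

end

theory Submission
  imports Defs
begin

text \<open>Let \<open>P\<close> be multiplication by the indicator of a ball \<open>E\<close> in \<open>G\<close>, and \<open>Q\<close> the projection of
  \<open>L\<^sup>2(G)\<close> given on the Fourier side by multiplication with the indicator of a ball \<open>S\<close> in the dual.
  If \<open>|E| |S| \<le> c\<^sup>2\<close>, then \<open>\<parallel>QP\<parallel> \<le> c\<close>, because the Fourier transform of \<open>Pf\<close> is bounded by
  \<open>\<parallel>Pf\<parallel>\<^sub>1 \<le> |E|\<^bsup>1/2\<^esup> \<parallel>Pf\<parallel>\<^sub>2\<close>, whence \<open>\<parallel>Pf\<parallel>\<^sup>2 + \<parallel>Qf\<parallel>\<^sup>2 \<le> (1 + c) \<parallel>f\<parallel>\<^sup>2\<close>. With \<open>c = 1 - 2 \<delta>\<close>,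
  the masses of \<open>f\<close> outside \<open>E\<close> and of its transform outside \<open>S\<close> add up to at least \<open>2 \<delta> \<parallel>f\<parallel>\<^sup>2\<close>;
  by polynomial growth this applies to all radii with \<open>r r' = R\<close> for a suitable \<open>R\<close>. Chebyshev's
  inequality at two radii on each side then bounds \<open>D / r\<^sup>2 + D' / r'\<^sup>2\<close> below by \<open>(8/3) \<delta> \<parallel>f\<parallel>\<^sup>2\<close>,
  where \<open>D\<close> and \<open>D'\<close> are the two dispersions, and balancing \<open>r\<close> against \<open>r'\<close> gives a lower bound
  for \<open>D D'\<close>.\<close>

section \<open>Square-integrable functions and their truncations\<close>

text \<open>The cross term 2 |x| |y| is split with a weight s. The case s = 1 makes
  \<open>L2\<close> closed under differences; a variable s later stands in for Minkowski's
  inequality.\<close>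

lemma norm_add_sq_le:
  fixes x y :: complex and s :: real
  assumes "s > 0"
  shows "(norm (x + y))\<^sup>2 \<le> (1 + s) * (norm x)\<^sup>2 + (1 + 1 / s) * (norm y)\<^sup>2"
proof -
  have "(norm (x + y))\<^sup>2 \<le> (norm x + norm y)\<^sup>2"
    by (simp add: norm_triangle_ineq power_mono)
  also have "\<dots> = (norm x)\<^sup>2 + 2 * (norm x * norm y) + (norm y)\<^sup>2"
    by (simp add: power2_eq_square algebra_simps)
  also have "2 * (norm x * norm y) \<le> s * (norm x)\<^sup>2 + (norm y)\<^sup>2 / s"
  proof -
    have "0 \<le> (s * norm x - norm y)\<^sup>2 / s"
      using assms by simp
    also have "\<dots> = s * (norm x)\<^sup>2 + (norm y)\<^sup>2 / s - 2 * (norm x * norm y)"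
      using assms by (simp add: field_simps power2_eq_square)
    finally show ?thesis by simp
  qed
  finally show ?thesis by (simp add: algebra_simps)
qed

lemma L2_measurable: "f \<in> L2 M \<Longrightarrow> f \<in> borel_measurable M"
  by (simp add: L2_def)

lemma L2_integrable: "f \<in> L2 M \<Longrightarrow> integrable M (\<lambda>x. (norm (f x))\<^sup>2)"
  by (simp add: L2_def)

lemma L2_diff:
  assumes "f \<in> L2 M" "g \<in> L2 M"
  shows "(\<lambda>x. f x - g x) \<in> L2 M"
proof -
  have [measurable]: "f \<in> borel_measurable M" "g \<in> borel_measurable M"
    using assms by (auto simp: L2_def)
  have int: "integrable M (\<lambda>x. 2 * (norm (f x))\<^sup>2 + 2 * (norm (g x))\<^sup>2)"
    using assms by (auto simp: L2_def)
  have "(norm (f x - g x))\<^sup>2 \<le> 2 * (norm (f x))\<^sup>2 + 2 * (norm (g x))\<^sup>2" for x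
    using norm_add_sq_le[of 1 "f x" "- g x"] by simp
  then have "integrable M (\<lambda>x. (norm (f x - g x))\<^sup>2)"
    by (intro Bochner_Integration.integrable_bound[OF int] AE_I2) simp_all
  then show ?thesis by (simp add: L2_def)
qed

lemma L2_cmult: "f \<in> L2 M \<Longrightarrow> (\<lambda>x. c * f x) \<in> L2 M"
  unfolding L2_def by (auto simp: norm_mult power_mult_distrib)

lemma L2_indicator:
  assumes "f \<in> L2 M" "S \<in> sets M"
  shows "(\<lambda>x. f x * indicator S x) \<in> L2 M"
proof -
  have [measurable]: "f \<in> borel_measurable M" "S \<in> sets M"
    using assms by (auto simp: L2_def)
  have "integrable M (\<lambda>x. (norm (f x * indicator S x))\<^sup>2)"
    by (intro Bochner_Integration.integrable_bound[OF L2_integrable[OF assms(1)]] AE_I2)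
      (simp_all add: indicator_def)
  then show ?thesis by (simp add: L2_def)
qed

lemma integrable_sq_indicator:
  assumes "f \<in> L2 M" "S \<in> sets M"
  shows "integrable M (\<lambda>x. (norm (f x))\<^sup>2 * indicator S x)"
  using integrable_real_mult_indicator[OF assms(2) L2_integrable[OF assms(1)]] by (simp add: mult.commute)

lemma L2_norm_sq: "(L2_norm M f)\<^sup>2 = (LINT x|M. (norm (f x))\<^sup>2)"
  unfolding L2_norm_def by simp

lemma nn_integral_L2:
  assumes "f \<in> L2 M"
  shows "(\<integral>\<^sup>+x. ennreal ((norm (f x))\<^sup>2) \<partial>M) = ennreal ((L2_norm M f)\<^sup>2)"
  unfolding L2_norm_sq by (rule nn_integral_eq_integral) (use assms in \<open>auto simp: L2_def\<close>)

text \<open>Cauchy-Schwarz against the indicator of S. Working with nonnegative integrals first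
  yields integrability and the L1 bound from the same computation.\<close>

lemma L2_indicator_integrable:
  assumes f: "f \<in> L2 M" and S: "S \<in> sets M" and fin: "emeasure M S < \<infinity>"
  shows "integrable M (\<lambda>x. f x * indicator S x)"
    and "(LINT x|M. norm (f x * indicator S x))\<^sup>2
          \<le> measure M S * (LINT x|M. (norm (f x))\<^sup>2 * indicator S x)"
proof -
  have [measurable]: "f \<in> borel_measurable M" "S \<in> sets M"
    using f S by (auto simp: L2_def)
  have "(\<integral>\<^sup>+x. ennreal (norm (f x * indicator S x)) \<partial>M)\<^sup>2
      = (\<integral>\<^sup>+x. indicator S x * ennreal (norm (f x * indicator S x)) \<partial>M)\<^sup>2"
    by (intro arg_cong[where f="\<lambda>x. x\<^sup>2"] nn_integral_cong) (auto simp: indicator_def)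
  also have "\<dots> \<le> (\<integral>\<^sup>+x. (indicator S x)\<^sup>2 \<partial>M) * (\<integral>\<^sup>+x. (ennreal (norm (f x * indicator S x)))\<^sup>2 \<partial>M)"
    by (rule Cauchy_Schwarz_nn_integral) auto
  also have "(\<integral>\<^sup>+x. (indicator S x)\<^sup>2 \<partial>M) = (\<integral>\<^sup>+x. indicator S x \<partial>M)"
    by (intro nn_integral_cong) (auto simp: indicator_def)
  also have "\<dots> = ennreal (measure M S)"
    using fin by (simp add: emeasure_eq_ennreal_measure)
  also have "(\<integral>\<^sup>+x. (ennreal (norm (f x * indicator S x)))\<^sup>2 \<partial>M)
      = (\<integral>\<^sup>+x. ennreal ((norm (f x))\<^sup>2 * indicator S x) \<partial>M)"
    by (intro nn_integral_cong) (auto simp: indicator_def ennreal_power)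
  also have "\<dots> = ennreal (LINT x|M. (norm (f x))\<^sup>2 * indicator S x)"
    by (intro nn_integral_eq_integral integrable_sq_indicator f S) auto
  finally have le: "(\<integral>\<^sup>+x. ennreal (norm (f x * indicator S x)) \<partial>M)\<^sup>2
      \<le> ennreal (measure M S * (LINT x|M. (norm (f x))\<^sup>2 * indicator S x))"
    by (simp add: ennreal_mult')
  have "(\<integral>\<^sup>+x. ennreal (norm (f x * indicator S x)) \<partial>M)\<^sup>2 < \<infinity>"
    using le_less_trans[OF le ennreal_less_top] by (simp only: infinity_ennreal_def)
  then have "(\<integral>\<^sup>+x. ennreal (norm (f x * indicator S x)) \<partial>M) < \<infinity>"
    by (simp only: infinity_ennreal_def power_less_top_ennreal) simp
  then show int: "integrable M (\<lambda>x. f x * indicator S x)"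
    by (intro integrableI_bounded) auto
  have "(\<integral>\<^sup>+x. ennreal (norm (f x * indicator S x)) \<partial>M) = ennreal (LINT x|M. norm (f x * indicator S x))"
    by (intro nn_integral_eq_integral integrable_norm int) auto
  with le have "ennreal ((LINT x|M. norm (f x * indicator S x))\<^sup>2)
          \<le> ennreal (measure M S * (LINT x|M. (norm (f x))\<^sup>2 * indicator S x))"
    by (simp only: ennreal_power Bochner_Integration.integral_nonneg norm_ge_zero)
  moreover have "0 \<le> measure M S * (LINT x|M. (norm (f x))\<^sup>2 * indicator S x)"
    by (intro mult_nonneg_nonneg Bochner_Integration.integral_nonneg) auto
  ultimately show "(LINT x|M. norm (f x * indicator S x))\<^sup>2
          \<le> measure M S * (LINT x|M. (norm (f x))\<^sup>2 * indicator S x)"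
    by (simp only: ennreal_le_iff)
qed

text \<open>The quantitative form of the operator inequality \<open>\<parallel>P + Q\<parallel> \<le> 1 + \<parallel>PQ\<parallel>\<close> for two orthogonal
  projections, read off from \<open>\<parallel>(1 + c) F - H - 1\<^sub>S F\<parallel>\<^sup>2 \<ge> 0\<close>; here \<open>H\<close> stands for \<open>PF\<close> and
  multiplication by \<open>1\<^sub>S\<close> for \<open>Q\<close>.\<close>
lemma projection_mass_bound:
  fixes F H :: "'a \<Rightarrow> complex" and a c :: real
  assumes F: "F \<in> L2 N" and H: "H \<in> L2 N" and S: "S \<in> sets N" and c: "c > 0"
    and normH: "(L2_norm N H)\<^sup>2 = a"
    and diff: "(L2_norm N (\<lambda>x. F x - H x))\<^sup>2 \<le> (L2_norm N F)\<^sup>2 - a"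
    and small: "(LINT x|N. (norm (H x))\<^sup>2 * indicator S x) \<le> c\<^sup>2 * a"
  shows "a + (LINT x|N. (norm (F x))\<^sup>2 * indicator S x) \<le> (1 + c) * (L2_norm N F)\<^sup>2"
proof -
  define t where "t = 1 + c"
  \<comment> \<open>The real cross term of F and H, written with squared norms so that its integral
    is a combination of \<open>L2_norm\<close> values.\<close>
  define s where "s x = (norm (F x))\<^sup>2 + (norm (H x))\<^sup>2 - (norm (F x - H x))\<^sup>2" for x
  let ?I = "\<lambda>x. indicator S x :: real"
  have s_eq: "s x = 2 * Re (F x * cnj (H x))" for x
    unfolding s_def cmod_power2 by (simp add: power2_eq_square algebra_simps)
  \<comment> \<open>The right-hand side is |tF - H|^2 off S and t/c times |cF - H|^2 on S. The
    weight t/c gives the cross term the same coefficient -t on both sets, so only its integral over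
    the whole space occurs, and \<open>diff\<close> controls that.\<close>
  have pw: "0 \<le> t\<^sup>2 * (norm (F x))\<^sup>2 - t * s x + (norm (H x))\<^sup>2
       + ((norm (H x))\<^sup>2 * ?I x) / c - t * ((norm (F x))\<^sup>2 * ?I x)" for x
  proof (cases "x \<in> S")
    case True
    have "0 \<le> t / c * (norm (c * F x - H x))\<^sup>2"
      using c by (simp add: t_def)
    also have "(norm (c * F x - H x))\<^sup>2 = c\<^sup>2 * (norm (F x))\<^sup>2 - c * s x + (norm (H x))\<^sup>2"
      unfolding s_eq cmod_power2 by (simp add: power2_eq_square algebra_simps)
    also have "t / c * \<dots> = t * c * (norm (F x))\<^sup>2 - t * s x + t / c * (norm (H x))\<^sup>2"
      using c by (simp add: field_simps power2_eq_square)
    finally show ?thesis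
      using True c by (simp add: t_def field_simps power2_eq_square)
  next
    case False
    have "0 \<le> (norm (t * F x - H x))\<^sup>2" by simp
    also have "(norm (t * F x - H x))\<^sup>2 = t\<^sup>2 * (norm (F x))\<^sup>2 - t * s x + (norm (H x))\<^sup>2"
      unfolding s_eq cmod_power2 by (simp add: power2_eq_square algebra_simps)
    finally show ?thesis using False by simp
  qed
  note ints = L2_integrable[OF F] L2_integrable[OF H] L2_integrable[OF L2_diff[OF F H]]
    integrable_sq_indicator[OF F S] integrable_sq_indicator[OF H S]
  define n where "n = (L2_norm N F)\<^sup>2"
  define w where "w = (L2_norm N (\<lambda>x. F x - H x))\<^sup>2"
  define b where "b = (LINT x|N. (norm (F x))\<^sup>2 * ?I x)"
  define h where "h = (LINT x|N. (norm (H x))\<^sup>2 * ?I x)"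
  have "0 \<le> (LINT x|N. t\<^sup>2 * (norm (F x))\<^sup>2 - t * s x + (norm (H x))\<^sup>2
       + ((norm (H x))\<^sup>2 * ?I x) / c - t * ((norm (F x))\<^sup>2 * ?I x))"
    by (intro Bochner_Integration.integral_nonneg pw)
  also have "\<dots> = t\<^sup>2 * n - t * (n + a - w) + a + h / c - t * b"
    using ints normH unfolding s_def n_def w_def b_def h_def
    by (simp add: L2_norm_sq)
  also have "\<dots> \<le> t\<^sup>2 * n - t * (2 * a) + a + c * a - t * b"
  proof -
    have "t * (2 * a) \<le> t * (n + a - w)"
      using diff c by (intro mult_left_mono) (auto simp: n_def w_def t_def)
    moreover have "h / c \<le> c * a"
      using small c by (simp add: h_def field_simps power2_eq_square)
    ultimately show ?thesis by linarith
  qed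
  also have "\<dots> = t * (t * n - (a + b))"
    by (simp add: t_def algebra_simps power2_eq_square)
  finally have "0 \<le> t * n - (a + b)"
    using c by (simp add: t_def zero_le_mult_iff)
  then show ?thesis by (simp add: t_def n_def b_def)
qed

section \<open>Mean-square limits and the Plancherel transform\<close>

text \<open>Integrated form of \<open>norm_add_sq_le\<close>. The unbounded coefficient 1 + 1/s
  falls on the part that will tend to 0, the coefficient close to 1 on the part that stays.\<close>

lemma L2_norm_triangle_sq:
  assumes u: "u \<in> L2 M" and v: "v \<in> L2 M" and w: "w \<in> L2 M" and s: "s > 0"
  shows "(L2_norm M (\<lambda>x. u x - w x))\<^sup>2
    \<le> (1 + 1 / s) * (L2_norm M (\<lambda>x. u x - v x))\<^sup>2 + (1 + s) * (L2_norm M (\<lambda>x. v x - w x))\<^sup>2"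
proof -
  note ints = L2_integrable[OF L2_diff[OF u v]] L2_integrable[OF L2_diff[OF v w]]
  have "(L2_norm M (\<lambda>x. u x - w x))\<^sup>2
    \<le> (LINT x|M. (1 + 1 / s) * (norm (u x - v x))\<^sup>2 + (1 + s) * (norm (v x - w x))\<^sup>2)"
    unfolding L2_norm_sq
  proof (rule integral_mono)
    show "integrable M (\<lambda>x. (norm (u x - w x))\<^sup>2)"
      by (rule L2_integrable[OF L2_diff[OF u w]])
    show "integrable M (\<lambda>x. (1 + 1 / s) * (norm (u x - v x))\<^sup>2 + (1 + s) * (norm (v x - w x))\<^sup>2)"
      by (intro Bochner_Integration.integrable_add integrable_mult_right ints)
    show "(norm (u x - w x))\<^sup>2 \<le> (1 + 1 / s) * (norm (u x - v x))\<^sup>2 + (1 + s) * (norm (v x - w x))\<^sup>2" for x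
      using norm_add_sq_le[of "1 / s" "u x - v x" "v x - w x"] s by simp
  qed
  also have "\<dots> = (1 + 1 / s) * (L2_norm M (\<lambda>x. u x - v x))\<^sup>2 + (1 + s) * (L2_norm M (\<lambda>x. v x - w x))\<^sup>2"
    unfolding L2_norm_sq
    by (subst Bochner_Integration.integral_add) (intro integrable_mult_right ints | simp)+
  finally show ?thesis .
qed

lemma L2_tendsto_norm:
  assumes "\<And>n. h n \<in> L2 M" "f \<in> L2 M" "L2_tendsto M h f"
  shows "(\<lambda>n. (L2_norm M (\<lambda>x. h n x - f x))\<^sup>2) \<longlonglongrightarrow> 0"
proof -
  have "(\<lambda>n. ennreal ((L2_norm M (\<lambda>x. h n x - f x))\<^sup>2)) \<longlonglongrightarrow> ennreal 0"
    using assms(3) nn_integral_L2[OF L2_diff[OF assms(1,2)]] by (simp add: L2_tendsto_def)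
  then show ?thesis
    by (subst (asm) tendsto_ennreal_iff) auto
qed

lemma L2_norm_minus_commute: "L2_norm M (\<lambda>x. f x - g x) = L2_norm M (\<lambda>x. g x - f x)"
  by (simp add: L2_norm_def norm_minus_commute)

text \<open>The property under SOME in \<open>plancherel\<close>, named so that its satisfiability
  can be discussed.\<close>

definition plancherel_limit ::
    "'a measure \<Rightarrow> ('a \<Rightarrow> complex) measure \<Rightarrow> ('a \<Rightarrow> complex) \<Rightarrow> (('a \<Rightarrow> complex) \<Rightarrow> complex) \<Rightarrow> bool" where
  "plancherel_limit M N f g \<longleftrightarrow> g \<in> L2 N \<and>
     (\<exists>h. (\<forall>n. h n \<in> L2 M \<and> integrable M (h n)) \<and>
          L2_tendsto M h f \<and> L2_tendsto N (\<lambda>n. fourier M (h n)) g)"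

lemma L2_tendsto_half:
  assumes "L2_tendsto M h (\<lambda>x. 2 * f x)"
  shows "L2_tendsto M (\<lambda>n x. 1 / 2 * h n x) f"
proof -
  have le: "(norm (1 / 2 * h n x - f x))\<^sup>2 \<le> (norm (h n x - 2 * f x))\<^sup>2" for n x
  proof -
    have "1 / 2 * h n x - f x = 1 / 2 * (h n x - 2 * f x)" by simp
    then have "norm (1 / 2 * h n x - f x) = 1 / 2 * norm (h n x - 2 * f x)"
      by (simp only: norm_mult) simp
    then have "norm (1 / 2 * h n x - f x) \<le> norm (h n x - 2 * f x)"
      using norm_ge_zero[of "h n x - 2 * f x"] by linarith
    then show ?thesis by (rule power_mono) simp
  qed
  show ?thesis
    unfolding L2_tendsto_def
    by (rule tendsto_sandwich[OF _ _ tendsto_const assms[unfolded L2_tendsto_def]])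
      (intro always_eventually allI nn_integral_mono ennreal_leI le | simp)+
qed

lemma plancherel_limit_half:
  assumes "plancherel_limit M N (\<lambda>x. 2 * f x) g"
  shows "plancherel_limit M N f (\<lambda>\<xi>. 1 / 2 * g \<xi>)"
proof -
  from assms obtain h where g: "g \<in> L2 N" and h: "\<And>n. h n \<in> L2 M" "\<And>n. integrable M (h n)"
    and lim: "L2_tendsto M h (\<lambda>x. 2 * f x)" "L2_tendsto N (\<lambda>n. fourier M (h n)) g"
    unfolding plancherel_limit_def by blast
  have "fourier M (\<lambda>x. 1 / 2 * h n x) = (\<lambda>\<xi>. 1 / 2 * fourier M (h n) \<xi>)" for n
    unfolding fourier_def by (simp add: mult.assoc)
  moreover have "L2_tendsto N (\<lambda>n \<xi>. 1 / 2 * fourier M (h n) \<xi>) (\<lambda>\<xi>. 1 / 2 * g \<xi>)"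
    by (rule L2_tendsto_half) (use lim(2) in simp)
  ultimately have "L2_tendsto N (\<lambda>n. fourier M (\<lambda>x. 1 / 2 * h n x)) (\<lambda>\<xi>. 1 / 2 * g \<xi>)"
    by simp
  then show ?thesis
    unfolding plancherel_limit_def
    by (intro conjI exI[of _ "\<lambda>n x. 1 / 2 * h n x"] allI integrable_mult_right
        L2_cmult g h L2_tendsto_half[OF lim(1)])
qed

text \<open>If no limit existed for \<open>f\<close>, there would be none for \<open>2f\<close> either, so \<open>SOME\<close> would select the
  same function for both, and the norm identity would give \<open>\<parallel>2f\<parallel> = \<parallel>f\<parallel>\<close>. This replaces the
  completeness of \<open>L\<^sup>2\<close>.\<close>
lemma plancherel_limit_plancherel:
  assumes norm: "plancherel_normalized M N" and f: "f \<in> L2 M" and nint: "\<not> integrable M f"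
  shows "plancherel_limit M N f (plancherel M N f)"
proof -
  have plan: "plancherel M N u = (SOME g. plancherel_limit M N u g)" if "\<not> integrable M u" for u
    using that by (simp add: plancherel_def plancherel_limit_def)
  have "\<exists>g. plancherel_limit M N f g"
  proof (rule ccontr)
    assume no: "\<nexists>g. plancherel_limit M N f g"
    then have "plancherel_limit M N (\<lambda>x. 2 * f x) = plancherel_limit M N f"
      using plancherel_limit_half by blast
    moreover have "\<not> integrable M (\<lambda>x. 2 * f x)"
      using nint integrable_mult_right[of "1 / 2" M "\<lambda>x. 2 * f x"] by auto
    ultimately have "plancherel M N (\<lambda>x. 2 * f x) = plancherel M N f"
      using plan nint by simp
    then have "L2_norm M (\<lambda>x. 2 * f x) = L2_norm M f"
      using norm f L2_cmult[OF f, of 2] unfolding plancherel_normalized_def by metis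
    then have "(L2_norm M (\<lambda>x. 2 * f x))\<^sup>2 = (L2_norm M f)\<^sup>2"
      by simp
    \<comment> \<open>The two sides are 4 times the integral and the integral itself. Its vanishing
      makes f zero almost everywhere, hence integrable, against \<open>nint\<close>.\<close>
    then have "(LINT x|M. (norm (f x))\<^sup>2) = 0"
      by (simp add: L2_norm_sq norm_mult power_mult_distrib)
    then have "AE x in M. (norm (f x))\<^sup>2 = 0"
      using integral_nonneg_eq_0_iff_AE[OF L2_integrable[OF f]] by simp
    then have "AE x in M. f x = 0"
      by simp
    then have "integrable M f \<longleftrightarrow> integrable M (\<lambda>x. 0 :: complex)"
      using L2_measurable[OF f] by (intro integrable_cong_AE) auto
    with nint show False by simp
  qed
  then show ?thesis
    unfolding plan[OF nint] by (rule someI_ex)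
qed

lemma plancherel_in_L2:
  assumes "plancherel_normalized M N" "f \<in> L2 M"
  shows "plancherel M N f \<in> L2 N" "L2_norm N (plancherel M N f) = L2_norm M f"
  using assms by (auto simp: plancherel_normalized_def)

lemma fourier_in_L2:
  assumes "plancherel_normalized M N" "f \<in> L2 M" "integrable M f"
  shows "fourier M f \<in> L2 N" "L2_norm N (fourier M f) = L2_norm M f"
  using plancherel_in_L2[OF assms(1,2)] assms(3) by (auto simp: plancherel_def)

lemma integrable_mult_cnj_unimodular:
  fixes f \<xi> :: "'a \<Rightarrow> complex"
  assumes f: "integrable M f" and \<xi>: "\<xi> \<in> borel_measurable M" "\<And>x. x \<in> space M \<Longrightarrow> norm (\<xi> x) = 1"
  shows "integrable M (\<lambda>x. f x * cnj (\<xi> x))"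
proof (rule Bochner_Integration.integrable_bound[OF f])
  have "cnj \<in> borel_measurable borel"
    by (intro borel_measurable_continuous_onI continuous_intros)
  then have "(\<lambda>x. cnj (\<xi> x)) \<in> borel_measurable M"
    using \<xi>(1) by (rule measurable_compose[rotated])
  then show "(\<lambda>x. f x * cnj (\<xi> x)) \<in> borel_measurable M"
    using f by (intro borel_measurable_times) auto
  show "AE x in M. norm (f x * cnj (\<xi> x)) \<le> norm (f x)"
    by (intro AE_I2) (simp add: norm_mult \<xi>(2))
qed

lemma fourier_norm_le:
  fixes f \<xi> :: "'a \<Rightarrow> complex"
  assumes "\<And>x. x \<in> space M \<Longrightarrow> norm (\<xi> x) = 1"
  shows "norm (fourier M f \<xi>) \<le> (LINT x|M. norm (f x))"
proof -
  have "norm (fourier M f \<xi>) \<le> (LINT x|M. norm (f x * cnj (\<xi> x)))"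
    unfolding fourier_def by (rule integral_norm_bound)
  also have "\<dots> = (LINT x|M. norm (f x))"
    by (intro Bochner_Integration.integral_cong) (simp_all add: norm_mult assms)
  finally show ?thesis .
qed

section \<open>Simultaneous concentration of a function and its transform\<close>

text \<open>Collects what the Fourier estimates take from the group: the isometry, and characters
  that are measurable and unimodular.\<close>

locale plancherel_pair =
  fixes M :: "'a measure" and N :: "('a \<Rightarrow> complex) measure"
  assumes normalized: "plancherel_normalized M N"
    and character_measurable: "\<And>\<xi>. \<xi> \<in> space N \<Longrightarrow> \<xi> \<in> borel_measurable M"
    and character_norm: "\<And>\<xi> x. \<xi> \<in> space N \<Longrightarrow> x \<in> space M \<Longrightarrow> norm (\<xi> x) = 1"
begin

lemma fourier_diff_norm:
  assumes "u \<in> L2 M" "v \<in> L2 M" "integrable M u" "integrable M v"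
  shows "L2_norm N (\<lambda>\<xi>. fourier M u \<xi> - fourier M v \<xi>) = L2_norm M (\<lambda>x. u x - v x)"
proof -
  have "fourier M (\<lambda>x. u x - v x) \<xi> = fourier M u \<xi> - fourier M v \<xi>" if "\<xi> \<in> space N" for \<xi>
  proof -
    note i = integrable_mult_cnj_unimodular[OF _ character_measurable character_norm, OF _ that that]
    show ?thesis
      using i[OF assms(3)] i[OF assms(4)] by (simp add: fourier_def left_diff_distrib)
  qed
  then have "L2_norm N (\<lambda>\<xi>. fourier M u \<xi> - fourier M v \<xi>) = L2_norm N (fourier M (\<lambda>x. u x - v x))"
    unfolding L2_norm_def by (intro arg_cong[where f=sqrt] Bochner_Integration.integral_cong) auto
  also have "\<dots> = L2_norm M (\<lambda>x. u x - v x)"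
    using assms by (intro fourier_in_L2[OF normalized] L2_diff Bochner_Integration.integrable_diff)
  finally show ?thesis .
qed

lemma plancherel_diff_norm_le:
  assumes f: "f \<in> L2 M" and g: "g \<in> L2 M" "integrable M g"
  shows "(L2_norm N (\<lambda>\<xi>. plancherel M N f \<xi> - fourier M g \<xi>))\<^sup>2 \<le> (L2_norm M (\<lambda>x. f x - g x))\<^sup>2"
proof (cases "integrable M f")
  case True
  then show ?thesis
    using fourier_diff_norm[OF f g(1) True g(2)] by (simp add: plancherel_def)
next
  case False
  let ?F = "plancherel M N f"
  define X where "X = (L2_norm N (\<lambda>\<xi>. ?F \<xi> - fourier M g \<xi>))\<^sup>2"
  define Y where "Y = (L2_norm M (\<lambda>x. f x - g x))\<^sup>2"
  obtain h where h: "\<And>n. h n \<in> L2 M" "\<And>n. integrable M (h n)"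
    and lim: "L2_tendsto M h f" "L2_tendsto N (\<lambda>n. fourier M (h n)) ?F"
    using plancherel_limit_plancherel[OF normalized f False] unfolding plancherel_limit_def by blast
  note F = plancherel_in_L2(1)[OF normalized f]
  note Fh = fourier_in_L2(1)[OF normalized h]
  note Fg = fourier_in_L2(1)[OF normalized g]
  define I where "I n = (L2_norm M (\<lambda>x. h n x - f x))\<^sup>2" for n
  define J where "J n = (L2_norm N (\<lambda>\<xi>. fourier M (h n) \<xi> - ?F \<xi>))\<^sup>2" for n
  have I0: "I \<longlonglongrightarrow> 0" and J0: "J \<longlonglongrightarrow> 0"
    unfolding I_def J_def using L2_tendsto_norm[OF h(1) f lim(1)] L2_tendsto_norm[OF Fh F lim(2)] by auto
  have le: "X \<le> (1 + s)\<^sup>2 * Y" if s: "s > 0" for s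
  proof -
    \<comment> \<open>Two weighted triangle inequalities, through \<open>fourier M (h n)\<close> on
      the dual side and through f on the group side, linked by the isometry for h n - g.\<close>
    have "X \<le> (1 + 1 / s) * J n + (1 + s) * ((1 + 1 / s) * I n + (1 + s) * Y)" for n
    proof -
      have "X \<le> (1 + 1 / s) * J n + (1 + s) * (L2_norm N (\<lambda>\<xi>. fourier M (h n) \<xi> - fourier M g \<xi>))\<^sup>2"
        unfolding X_def J_def L2_norm_minus_commute[of N "fourier M (h n)" ?F]
        by (rule L2_norm_triangle_sq[OF F Fh Fg s])
      also have "L2_norm N (\<lambda>\<xi>. fourier M (h n) \<xi> - fourier M g \<xi>) = L2_norm M (\<lambda>x. h n x - g x)"
        by (rule fourier_diff_norm[OF h(1) g(1) h(2) g(2)])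
      also have "(L2_norm M (\<lambda>x. h n x - g x))\<^sup>2 \<le> (1 + 1 / s) * I n + (1 + s) * Y"
        unfolding I_def Y_def by (rule L2_norm_triangle_sq[OF h(1) f g(1) s])
      finally show ?thesis using s by (simp add: mult_left_mono)
    qed
    moreover have "(\<lambda>n. (1 + 1 / s) * J n + (1 + s) * ((1 + 1 / s) * I n + (1 + s) * Y))
        \<longlonglongrightarrow> (1 + 1 / s) * 0 + (1 + s) * ((1 + 1 / s) * 0 + (1 + s) * Y)"
      by (intro tendsto_intros I0 J0)
    ultimately have "X \<le> (1 + 1 / s) * 0 + (1 + s) * ((1 + 1 / s) * 0 + (1 + s) * Y)"
      by (intro LIMSEQ_le_const) auto
    then show ?thesis by (simp add: power2_eq_square mult.assoc)
  qed
  \<comment> \<open>The loss (1 + s)^2 disappears as s decreases to 0.\<close>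
  have "((\<lambda>s. (1 + s)\<^sup>2 * Y) \<longlongrightarrow> (1 + 0)\<^sup>2 * Y) (at_right (0 :: real))"
    by (intro tendsto_intros)
  moreover have "eventually (\<lambda>s. X \<le> (1 + s)\<^sup>2 * Y) (at_right (0 :: real))"
    using le by (auto simp: eventually_at_filter)
  ultimately have "X \<le> (1 + 0)\<^sup>2 * Y"
    by (rule tendsto_lowerbound) simp
  then show ?thesis by (simp add: X_def Y_def)
qed

text \<open>Truncating f to E gives an integrable g, whose transform is a genuine Fourier integral
  with squared modulus at most |E| a, where a is the mass of f on E. Integration over S gives |E|
  |S| a, at most c^2 a, which is the smallness hypothesis of
  \<open>projection_mass_bound\<close>.\<close>

lemma concentration_uncertainty:
  assumes f: "f \<in> L2 M" and E: "E \<in> sets M" "emeasure M E < \<infinity>"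
    and S: "S \<in> sets N" "emeasure N S < \<infinity>"
    and c: "c > 0" "measure M E * measure N S \<le> c\<^sup>2"
  shows "(LINT x|M. (norm (f x))\<^sup>2 * indicator E x)
       + (LINT \<xi>|N. (norm (plancherel M N f \<xi>))\<^sup>2 * indicator S \<xi>) \<le> (1 + c) * (L2_norm M f)\<^sup>2"
proof -
  define g where "g = (\<lambda>x. f x * indicator E x)"
  define a where "a = (LINT x|M. (norm (f x))\<^sup>2 * indicator E x)"
  have g: "g \<in> L2 M" "integrable M g"
    unfolding g_def by (rule L2_indicator[OF f E(1)], rule L2_indicator_integrable(1)[OF f E])
  have a0: "0 \<le> a"
    unfolding a_def by (intro Bochner_Integration.integral_nonneg) auto
  have norm_g: "(L2_norm M g)\<^sup>2 = a"
    unfolding L2_norm_sq a_def g_def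
    by (intro Bochner_Integration.integral_cong) (auto simp: indicator_def)
  have "(L2_norm M (\<lambda>x. f x - g x))\<^sup>2 = (LINT x|M. (norm (f x))\<^sup>2 - (norm (f x))\<^sup>2 * indicator E x)"
    unfolding L2_norm_sq g_def
    by (intro Bochner_Integration.integral_cong) (auto simp: indicator_def)
  also have "\<dots> = (L2_norm M f)\<^sup>2 - a"
    using L2_integrable[OF f] integrable_sq_indicator[OF f E(1)] by (simp add: L2_norm_sq a_def)
  finally have diff: "(L2_norm N (\<lambda>\<xi>. plancherel M N f \<xi> - fourier M g \<xi>))\<^sup>2 \<le> (L2_norm M f)\<^sup>2 - a"
    using plancherel_diff_norm_le[OF f g] by simp
  have bound: "(norm (fourier M g \<xi>))\<^sup>2 \<le> measure M E * a" if "\<xi> \<in> space N" for \<xi>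
  proof -
    have "(norm (fourier M g \<xi>))\<^sup>2 \<le> (LINT x|M. norm (g x))\<^sup>2"
      using character_norm[OF that] by (intro power_mono fourier_norm_le) auto
    also have "\<dots> \<le> measure M E * a"
      unfolding a_def g_def by (rule L2_indicator_integrable(2)[OF f E])
    finally show ?thesis .
  qed
  have "(LINT \<xi>|N. (norm (fourier M g \<xi>))\<^sup>2 * indicator S \<xi>) \<le> (LINT \<xi>|N. measure M E * a * indicator S \<xi>)"
  proof (rule integral_mono)
    show "integrable N (\<lambda>\<xi>. (norm (fourier M g \<xi>))\<^sup>2 * indicator S \<xi>)"
      by (intro integrable_sq_indicator fourier_in_L2(1)[OF normalized g] S)
    show "integrable N (\<lambda>\<xi>. measure M E * a * indicator S \<xi>)"
      using S by (intro integrable_mult_right integrable_real_indicator)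
  qed (use bound in \<open>auto simp: indicator_def\<close>)
  also have "\<dots> = measure M E * measure N S * a"
    using S by simp
  also have "\<dots> \<le> c\<^sup>2 * a"
    using c a0 by (intro mult_right_mono)
  finally have small: "(LINT \<xi>|N. (norm (fourier M g \<xi>))\<^sup>2 * indicator S \<xi>) \<le> c\<^sup>2 * a" .
  have "(L2_norm N (fourier M g))\<^sup>2 = a"
    using fourier_in_L2(2)[OF normalized g] norm_g by simp
  from projection_mass_bound[OF plancherel_in_L2(1)[OF normalized f] fourier_in_L2(1)[OF normalized g]
      S(1) c(1) this _ small] diff
  show ?thesis
    unfolding plancherel_in_L2(2)[OF normalized f] a_def by simp
qed

end

section \<open>Haar measures and the dual group\<close>

lemma haar_measure_space: "haar_measure G T M \<Longrightarrow> space M = topspace T"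
  by (simp add: haar_measure_def)

lemma haar_measure_continuous_measurable:
  fixes \<phi> :: "'a \<Rightarrow> 'b :: topological_space"
  assumes "haar_measure G T M" and \<phi>: "continuous_map T euclidean \<phi>"
  shows "\<phi> \<in> borel_measurable M"
proof (rule borel_measurableI)
  fix U :: "'b set" assume "open U"
  then have "openin T {x \<in> topspace T. \<phi> x \<in> U}"
    using \<phi> by (simp add: continuous_map_def)
  moreover have "\<phi> -` U \<inter> space M = {x \<in> topspace T. \<phi> x \<in> U}"
    using assms(1) by (auto simp: haar_measure_def)
  ultimately show "\<phi> -` U \<inter> space M \<in> sets M"
    using assms(1) by (simp add: haar_measure_def sigma_sets.Basic)
qed

lemma carrier_dual_group:
  "\<xi> \<in> carrier (dual_group G T) \<longleftrightarrow>
     (\<forall>x\<in>carrier G. norm (\<xi> x) = 1) \<and>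
     (\<forall>x\<in>carrier G. \<forall>y\<in>carrier G. \<xi> (x \<otimes>\<^bsub>G\<^esub> y) = \<xi> x * \<xi> y) \<and>
     continuous_map T euclidean \<xi> \<and> \<xi> \<in> extensional (carrier G)"
  by (auto simp: dual_group_def circle_group_def hom_def)

lemma mult_dual_group: "\<xi> \<otimes>\<^bsub>dual_group G T\<^esub> \<eta> = (\<lambda>x\<in>carrier G. \<xi> x * \<eta> x)"
  by (simp add: dual_group_def)

lemma one_dual_group: "\<one>\<^bsub>dual_group G T\<^esub> = (\<lambda>x\<in>carrier G. 1)"
  by (simp add: dual_group_def)

text \<open>Needed to treat the dual by the same ball estimates as G. The inverse of a character is
  its complex conjugate, by unimodularity.\<close>

lemma group_dual_group:
  assumes "group G" and top: "topspace T = carrier G"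
  shows "group (dual_group G T)"
proof -
  interpret group G by fact
  have cont: "continuous_map T euclidean (\<lambda>x\<in>carrier G. \<phi> x)"
    if "continuous_map T euclidean \<phi>" for \<phi> :: "'a \<Rightarrow> complex"
    using that by (rule continuous_map_eq) (simp add: top)
  show ?thesis
  proof (rule groupI)
    fix \<xi> \<eta> assume "\<xi> \<in> carrier (dual_group G T)" "\<eta> \<in> carrier (dual_group G T)"
    moreover from this have "continuous_map T euclidean (\<lambda>x\<in>carrier G. \<xi> x * \<eta> x)"
      by (intro cont) (auto simp: carrier_dual_group continuous_map_atin intro!: tendsto_mult)
    ultimately show "\<xi> \<otimes>\<^bsub>dual_group G T\<^esub> \<eta> \<in> carrier (dual_group G T)"
      by (simp add: carrier_dual_group mult_dual_group norm_mult mult_ac)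
  next
    have "continuous_map T euclidean (\<lambda>x\<in>carrier G. 1 :: complex)"
      by (intro cont) simp
    then show "\<one>\<^bsub>dual_group G T\<^esub> \<in> carrier (dual_group G T)"
      by (simp add: carrier_dual_group one_dual_group)
  next
    fix \<xi> \<eta> \<zeta>
    show "(\<xi> \<otimes>\<^bsub>dual_group G T\<^esub> \<eta>) \<otimes>\<^bsub>dual_group G T\<^esub> \<zeta>
        = \<xi> \<otimes>\<^bsub>dual_group G T\<^esub> (\<eta> \<otimes>\<^bsub>dual_group G T\<^esub> \<zeta>)"
      by (auto simp: mult_dual_group fun_eq_iff restrict_def)
  next
    fix \<xi> assume \<xi>: "\<xi> \<in> carrier (dual_group G T)"
    then show "\<one>\<^bsub>dual_group G T\<^esub> \<otimes>\<^bsub>dual_group G T\<^esub> \<xi> = \<xi>"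
      by (auto simp: mult_dual_group one_dual_group carrier_dual_group fun_eq_iff restrict_def
          extensional_def)
    let ?\<eta> = "\<lambda>x\<in>carrier G. cnj (\<xi> x)"
    have "continuous_map T euclidean ?\<eta>"
      using \<xi> by (intro cont) (auto simp: carrier_dual_group continuous_map_atin intro!: tendsto_cnj)
    then have "?\<eta> \<in> carrier (dual_group G T)"
      using \<xi> by (simp add: carrier_dual_group)
    moreover have "cnj (\<xi> x) * \<xi> x = 1" if "x \<in> carrier G" for x
      using \<xi> that by (metis carrier_dual_group complex_norm_square mult.commute of_real_1 power_one)
    then have "?\<eta> \<otimes>\<^bsub>dual_group G T\<^esub> \<xi> = \<one>\<^bsub>dual_group G T\<^esub>"
      by (auto simp: mult_dual_group one_dual_group fun_eq_iff restrict_def)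
    ultimately show "\<exists>\<eta>\<in>carrier (dual_group G T). \<eta> \<otimes>\<^bsub>dual_group G T\<^esub> \<xi> = \<one>\<^bsub>dual_group G T\<^esub>"
      by blast
  qed
qed

text \<open>The subbasic set with \<open>K = {}\<close> is the whole dual group.\<close>
lemma topspace_dual_topology: "topspace (dual_topology G T) = carrier (dual_group G T)"
proof -
  have "compactin T {}" "open (UNIV :: complex set)" by auto
  then show ?thesis
    unfolding dual_topology_def topology_generated_by_topspace by blast
qed

section \<open>Balls, masses and dispersion under polynomial growth\<close>

text \<open>Interpreted once for G and once for its dual, so that each metric estimate serves both
  sides.\<close>

locale haar_metric_group = group G for G (structure) +
  fixes T :: "'a topology" and M :: "'a measure" and d :: "'a \<Rightarrow> 'a \<Rightarrow> real" and t A :: real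
  assumes topspace: "topspace T = carrier G"
    and haar: "haar_measure G T M"
    and continuous: "continuous_metric G T d"
    and invariant: "invariant_metric G d"
    and growth: "polynomial_growth G M d t A"
    and t_pos: "t > 0"
    and A_pos: "A > 0"
begin

sublocale Metric_space "carrier G" d
  using continuous by (simp add: continuous_metric_def)

lemma space_eq: "space M = carrier G"
  using haar_measure_space[OF haar] topspace by simp

lemma dist_measurable:
  assumes a: "a \<in> carrier G"
  shows "(\<lambda>x. d x a) \<in> borel_measurable M"
proof (rule haar_measure_continuous_measurable[OF haar])
  have "continuous_map T (prod_topology T T) (\<lambda>x. (x, a))"
    using a topspace by (intro continuous_map_pairedI) auto
  moreover have "continuous_map (prod_topology T T) euclidean (\<lambda>(x, y). d x y)"
    using continuous by (simp add: continuous_metric_def)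
  ultimately have "continuous_map T euclidean ((\<lambda>(x, y). d x y) \<circ> (\<lambda>x. (x, a)))"
    by (rule continuous_map_compose)
  then show "continuous_map T euclidean (\<lambda>x. d x a)"
    by (simp add: o_def)
qed

text \<open>The arguments of d are ordered as in \<open>dispersion\<close>, and the complement in
  \<open>space M\<close> is exactly the set in \<open>outside_mass\<close>.\<close>

definition dball :: "'a \<Rightarrow> real \<Rightarrow> 'a set" where
  "dball a r = {x \<in> space M. d x a < r}"

definition outside_mass :: "('a \<Rightarrow> complex) \<Rightarrow> 'a \<Rightarrow> real \<Rightarrow> real" where
  "outside_mass f a r = (LINT x|M. (norm (f x))\<^sup>2 * indicator {x \<in> space M. r \<le> d x a} x)"

lemma sets_dball: "a \<in> carrier G \<Longrightarrow> dball a r \<in> sets M"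
  unfolding dball_def using dist_measurable by simp

lemma sets_outside: "a \<in> carrier G \<Longrightarrow> {x \<in> space M. r \<le> d x a} \<in> sets M"
  using dist_measurable by simp

text \<open>Translation by a is an isometry, undone by translation by the inverse of a. This carries
  the growth bound from the neutral element to every centre.\<close>

lemma dball_translate:
  assumes a: "a \<in> carrier G"
  shows "dball a r = (\<lambda>y. a \<otimes> y) ` mball \<one> r"
proof (intro equalityI subsetI)
  fix x assume "x \<in> dball a r"
  then have x: "x \<in> carrier G" "d x a < r" by (auto simp: dball_def space_eq)
  have "d (a \<otimes> \<one>) (a \<otimes> (inv a \<otimes> x)) = d \<one> (inv a \<otimes> x)"
    using invariant a x(1) unfolding invariant_metric_def by blast
  moreover have "a \<otimes> (inv a \<otimes> x) = x"
    using a x(1) by (simp add: m_assoc[symmetric])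
  ultimately have "inv a \<otimes> x \<in> mball \<one> r"
    using a x commute by simp
  with \<open>a \<otimes> (inv a \<otimes> x) = x\<close> show "x \<in> (\<lambda>y. a \<otimes> y) ` mball \<one> r"
    by (metis imageI)
next
  fix x assume "x \<in> (\<lambda>y. a \<otimes> y) ` mball \<one> r"
  then obtain y where y: "y \<in> carrier G" "d \<one> y < r" "x = a \<otimes> y" by auto
  have "d (a \<otimes> \<one>) (a \<otimes> y) = d \<one> y"
    using invariant a y(1) unfolding invariant_metric_def by blast
  then show "x \<in> dball a r"
    using a y commute by (simp add: dball_def space_eq)
qed

lemma dball_one: "dball \<one> r = mball \<one> r"
  using commute by (auto simp: dball_def space_eq)

lemma emeasure_dball_le:
  assumes a: "a \<in> carrier G" and r: "r > 0"
  shows "emeasure M (dball a r) \<le> ennreal (A * r powr t)"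
proof -
  have "emeasure M (dball a r) = emeasure M (mball \<one> r)"
    using haar a sets_dball[of \<one> r] unfolding dball_translate[OF a] haar_measure_def dball_one
    by simp
  then show ?thesis
    using growth r by (simp add: polynomial_growth_def)
qed

lemma measure_dball_le:
  assumes a: "a \<in> carrier G" and r: "r > 0"
  shows "emeasure M (dball a r) < \<infinity>" "measure M (dball a r) \<le> A * r powr t"
proof -
  show fin: "emeasure M (dball a r) < \<infinity>"
    using emeasure_dball_le[OF assms] le_less_trans[OF _ ennreal_less_top]
    unfolding infinity_ennreal_def by blast
  then show "measure M (dball a r) \<le> A * r powr t"
    using emeasure_dball_le[OF assms] A_pos
    by (simp add: emeasure_eq_ennreal_measure)
qed

text \<open>The point lies in balls of measure at most A r^t, and this tends to 0 with r because t >
  0.\<close>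

lemma emeasure_point:
  assumes a: "a \<in> carrier G"
  shows "emeasure M {x \<in> space M. x = a} = 0"
proof -
  have "emeasure M {x \<in> space M. x = a} \<le> ennreal (A * r powr t)" if r: "r > 0" for r
  proof -
    have "{x \<in> space M. x = a} \<subseteq> dball a r"
      using r a by (auto simp: dball_def)
    then have "emeasure M {x \<in> space M. x = a} \<le> emeasure M (dball a r)"
      by (rule emeasure_mono[OF _ sets_dball[OF a]])
    also have "\<dots> \<le> ennreal (A * r powr t)"
      by (rule emeasure_dball_le[OF a r])
    finally show ?thesis .
  qed
  then have "eventually (\<lambda>r. emeasure M {x \<in> space M. x = a} \<le> ennreal (A * r powr t)) (at_right 0)"
    by (auto simp: eventually_at_filter)
  moreover have "((\<lambda>r. ennreal (A * r powr t)) \<longlongrightarrow> ennreal (A * 0 powr t)) (at_right 0)"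
  proof (intro tendsto_ennrealI tendsto_mult tendsto_const)
    show "((\<lambda>r. r powr t) \<longlongrightarrow> 0 powr t) (at_right 0)"
      by (rule tendsto_powr2) (use t_pos in \<open>auto simp: eventually_at_filter intro!: tendsto_intros\<close>)
  qed
  ultimately have "emeasure M {x \<in> space M. x = a} \<le> ennreal (A * 0 powr t)"
    by (intro tendsto_lowerbound) auto
  then show ?thesis by simp
qed

text \<open>The weight vanishes only at a, which is a null set. For nonzero f this excludes the
  product of 0 and infinity, which is 0 in \<open>ennreal\<close>.\<close>

lemma dispersion_eq_0D:
  assumes a: "a \<in> carrier G" and f: "f \<in> L2 M" and 0: "dispersion M d a f = 0"
  shows "L2_norm M f = 0"
proof -
  have [measurable]: "f \<in> borel_measurable M" "(\<lambda>x. d x a) \<in> borel_measurable M"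
    using f dist_measurable[OF a] by (auto simp: L2_def)
  have "AE x in M. ennreal ((d x a)\<^sup>2 * (norm (f x))\<^sup>2) = 0"
    using 0 unfolding dispersion_def by (subst (asm) nn_integral_0_iff_AE) auto
  moreover have "{x \<in> space M. x = a} \<in> null_sets M"
  proof -
    have "{x \<in> space M. x = a} = {x \<in> space M. d x a \<le> 0}"
      using a by (auto simp: space_eq) (metis nonneg order_antisym zero)
    also have "\<dots> \<in> sets M" by simp
    finally show ?thesis using emeasure_point[OF a] by auto
  qed
  then have "AE x in M. x \<noteq> a"
    by (rule AE_I') auto
  ultimately have "AE x in M. (norm (f x))\<^sup>2 = 0"
    using AE_space
  proof eventually_elim
    case (elim x)
    then have "d x a \<noteq> 0"
      using a zero by (auto simp: space_eq)
    with elim show ?case by (simp add: ennreal_eq_0_iff mult_le_0_iff)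
  qed
  then have "(LINT x|M. (norm (f x))\<^sup>2) = 0"
    by (rule integral_eq_zero_AE)
  then show ?thesis by (simp add: L2_norm_def)
qed

lemma inside_mass:
  assumes a: "a \<in> carrier G" and f: "f \<in> L2 M"
  shows "(LINT x|M. (norm (f x))\<^sup>2 * indicator (dball a r) x) = (L2_norm M f)\<^sup>2 - outside_mass f a r"
proof -
  have "(LINT x|M. (norm (f x))\<^sup>2 * indicator (dball a r) x)
      = (LINT x|M. (norm (f x))\<^sup>2 - (norm (f x))\<^sup>2 * indicator {x \<in> space M. r \<le> d x a} x)"
    by (intro Bochner_Integration.integral_cong) (auto simp: indicator_def dball_def)
  then show ?thesis
    using L2_integrable[OF f] integrable_sq_indicator[OF f sets_outside[OF a]]
    by (simp add: L2_norm_sq outside_mass_def)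
qed

text \<open>Chebyshev's inequality at two radii at once. A single radius would only give the uncertainty
  bound with \<open>\<delta>\<^sup>2\<close> in place of \<open>(16/9) \<delta>\<^sup>2\<close>, which does not dominate \<open>(2 \<delta> - \<delta>\<^sup>2)\<^sup>4\<close>
  on all of \<open>(0, 1/2)\<close>.\<close>
lemma dispersion_ge:
  assumes a: "a \<in> carrier G" and f: "f \<in> L2 M" and r: "r > 0"
  shows "ennreal (2 / 3 * r\<^sup>2 * (outside_mass f a (r / sqrt (3/2)) + outside_mass f a (r * sqrt (3/2))))
     \<le> dispersion M d a f"
proof -
  define U where "U s = {x \<in> space M. s \<le> d x a}" for s
  \<comment> \<open>Reciprocal factors k = sqrt (3/2) keep products of paired radii unchanged.
    Beyond \<open>?v\<close> both indicators count, which requires 2 / k^2 \<le> k^2; here k^2 = 3/2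
    is a rational value slightly above sqrt 2.\<close>
  let ?u = "r / sqrt (3/2)" and ?v = "r * sqrt (3/2)"
  let ?g = "\<lambda>x. 2 / 3 * r\<^sup>2 * ((norm (f x))\<^sup>2 * indicator (U ?u) x + (norm (f x))\<^sup>2 * indicator (U ?v) x)"
  have int: "integrable M (\<lambda>x. (norm (f x))\<^sup>2 * indicator (U s) x)" for s
    unfolding U_def by (rule integrable_sq_indicator[OF f sets_outside[OF a]])
  have pw: "?g x \<le> (d x a)\<^sup>2 * (norm (f x))\<^sup>2" for x
  proof -
    have u: "2 / 3 * r\<^sup>2 \<le> (d x a)\<^sup>2" if "?u \<le> d x a"
      using power_mono[OF that, of 2] r by (simp add: power_divide)
    have v: "3 / 2 * r\<^sup>2 \<le> (d x a)\<^sup>2" if "?v \<le> d x a"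
      using power_mono[OF that, of 2] r by (simp add: power_mult_distrib)
    have "2 / 3 * r\<^sup>2 * (indicator (U ?u) x + indicator (U ?v) x) \<le> (d x a)\<^sup>2"
    proof (cases "x \<in> U ?v")
      case True
      then have "3 / 2 * r\<^sup>2 \<le> (d x a)\<^sup>2"
        by (intro v) (simp add: U_def)
      moreover have "2 / 3 * r\<^sup>2 * (indicator (U ?u) x + indicator (U ?v) x) \<le> 4 / 3 * r\<^sup>2"
        by (simp add: indicator_def)
      ultimately show ?thesis
        using zero_le_power2[of r] by linarith
    next
      case False
      then show ?thesis
        using u by (auto simp: indicator_def U_def)
    qed
    from mult_right_mono[OF this, of "(norm (f x))\<^sup>2"] show ?thesis
      by (simp add: algebra_simps)
  qed
  have "ennreal (2 / 3 * r\<^sup>2 * (outside_mass f a ?u + outside_mass f a ?v)) = ennreal (LINT x|M. ?g x)"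
    using int by (simp add: outside_mass_def U_def)
  also have "\<dots> = (\<integral>\<^sup>+x. ennreal (?g x) \<partial>M)"
  proof (rule nn_integral_eq_integral[symmetric])
    show "integrable M ?g"
      by (intro integrable_mult_right Bochner_Integration.integrable_add int)
  qed simp
  also have "\<dots> \<le> dispersion M d a f"
    unfolding dispersion_def by (intro nn_integral_mono ennreal_leI pw)
  finally show ?thesis .
qed

end

section \<open>The constant and elementary inequalities\<close>

lemma alpha_attained:
  assumes t: "t > 0"
  obtains \<delta> where "0 < \<delta>" "\<delta> < 1/2" "alpha t = (1 - 2 * \<delta>) powr (4 / t) * (2 * \<delta> - \<delta>\<^sup>2) ^ 4"
proof -
  define \<phi> :: "real \<Rightarrow> real" where "\<phi> \<delta> = (1 - 2 * \<delta>) powr (4 / t) * (2 * \<delta> - \<delta>\<^sup>2) ^ 4" for \<delta>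
  have "continuous_on {0..1/2} \<phi>"
    unfolding \<phi>_def using t by (intro continuous_intros continuous_on_powr') auto
  then obtain \<delta> where \<delta>: "\<delta> \<in> {0..1/2}" "\<And>x. x \<in> {0..1/2} \<Longrightarrow> \<phi> x \<le> \<phi> \<delta>"
    using continuous_attains_sup[of "{0..1/2 :: real}" \<phi>] by auto
  have "0 < \<phi> (1/4)"
    by (simp add: \<phi>_def power2_eq_square)
  then have "0 < \<phi> \<delta>"
    using \<delta>(2)[of "1/4"] by simp
  \<comment> \<open>At 1/2 this rests on the convention that 0 powr x is 0.\<close>
  moreover have "\<phi> 0 = 0" "\<phi> (1/2) = 0"
    by (auto simp: \<phi>_def)
  ultimately have "\<delta> \<noteq> 0" "\<delta> \<noteq> 1/2"
    by (metis less_irrefl)+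
  then have in_open: "0 < \<delta>" "\<delta> < 1/2"
    using \<delta>(1) by auto
  have "alpha t = \<phi> \<delta>"
    unfolding alpha_def \<phi>_def[symmetric]
    by (rule Greatest_equality) (use in_open \<delta>(2) in auto)
  then show ?thesis
    using that in_open by (simp add: \<phi>_def)
qed

text \<open>On the curve r r' = R the sum is smallest when its two terms agree. With p and q the
  roots of D and D', this happens at r^2 = R p / q and r'^2 = R q / p, where the sum is 2 p q /
  R.\<close>

lemma product_ge_of_scaled_sum_ge:
  fixes D D' K R :: real
  assumes pos: "D > 0" "D' > 0" "K \<ge> 0" "R > 0"
    and le: "\<And>r r'. r > 0 \<Longrightarrow> r' > 0 \<Longrightarrow> r * r' = R \<Longrightarrow> K \<le> D / r\<^sup>2 + D' / r'\<^sup>2"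
  shows "(K * R / 2)\<^sup>2 \<le> D * D'"
proof -
  define p where "p = sqrt D" define q where "q = sqrt D'"
  have p: "p > 0" "D = p\<^sup>2" and q: "q > 0" "D' = q\<^sup>2"
    using pos by (auto simp: p_def q_def)
  have "(sqrt (R * p / q)) * (sqrt (R * q / p)) = sqrt (R\<^sup>2)"
    using p q pos by (simp add: real_sqrt_mult[symmetric] power2_eq_square)
  then have "K \<le> D / (sqrt (R * p / q))\<^sup>2 + D' / (sqrt (R * q / p))\<^sup>2"
    using p q pos by (intro le) auto
  also have "\<dots> = 2 * (p * q) / R"
    using p q pos by (simp add: field_simps power2_eq_square)
  finally have "K * R / 2 \<le> p * q"
    using pos by (simp add: field_simps)
  then have "(K * R / 2)\<^sup>2 \<le> (p * q)\<^sup>2"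
    using pos by (intro power_mono) auto
  then show ?thesis by (simp add: p(2) q(2) power_mult_distrib)
qed

text \<open>Compares the polynomial factor of \<open>alpha\<close> with the constant that
  Chebyshev's inequality yields. Taking a square root and cancelling \<delta> reduces it to \<delta>
  (2 - \<delta>)^2 \<le> 4/3.\<close>

lemma delta_polynomial_le:
  fixes \<delta> :: real
  assumes "0 < \<delta>" "\<delta> < 1/2"
  shows "(2 * \<delta> - \<delta>\<^sup>2) ^ 4 \<le> (4 / 3 * \<delta>)\<^sup>2"
proof -
  \<comment> \<open>The left-hand side at \<delta> = 1/2 is 5/24; the rest is divided by 1/2 -
    \<delta> and the quotient completed to a square.\<close>
  have eq: "4 / 3 - \<delta> * (2 - \<delta>)\<^sup>2 = (1/2 - \<delta>) * ((\<delta> - 7/4)\<^sup>2 - 13/16) + 5/24"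
    by (simp add: power2_eq_square field_simps)
  have "(5/4)\<^sup>2 \<le> (7/4 - \<delta>)\<^sup>2"
    using assms by (intro power_mono) auto
  then have "13/16 \<le> (\<delta> - 7/4)\<^sup>2"
    unfolding power2_commute[of \<delta>] by (simp add: power_divide)
  then have "0 \<le> (1/2 - \<delta>) * ((\<delta> - 7/4)\<^sup>2 - 13/16)"
    using assms by (intro mult_nonneg_nonneg) auto
  then have "0 \<le> 4 / 3 - \<delta> * (2 - \<delta>)\<^sup>2"
    unfolding eq by simp
  then have "\<delta> * (2 - \<delta>)\<^sup>2 \<le> 4 / 3"
    by simp
  then have "\<delta> * (\<delta> * (2 - \<delta>)\<^sup>2) \<le> \<delta> * (4 / 3)"
    using assms by (intro mult_left_mono) auto
  then have "(2 * \<delta> - \<delta>\<^sup>2)\<^sup>2 \<le> 4 / 3 * \<delta>"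
    by (simp add: power2_eq_square algebra_simps)
  then have "((2 * \<delta> - \<delta>\<^sup>2)\<^sup>2)\<^sup>2 \<le> (4 / 3 * \<delta>)\<^sup>2"
    by (intro power_mono) auto
  then show ?thesis by simp
qed

section \<open>From mass estimates to the product of dispersions\<close>

theorem theorem3:
  fixes G :: "('a, 'm) monoid_scheme" and T :: "'a topology"
    and M :: "'a measure" and N :: "('a \<Rightarrow> complex) measure"
    and d :: "'a \<Rightarrow> 'a \<Rightarrow> real" and d' :: "('a \<Rightarrow> complex) \<Rightarrow> ('a \<Rightarrow> complex) \<Rightarrow> real"
    and t A A' :: real and f :: "'a \<Rightarrow> complex"
  assumes "lca_group G T"
    and "haar_measure G T M"
    and "haar_measure (dual_group G T) (dual_topology G T) N"
    and "plancherel_normalized M N"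
    and "continuous_metric G T d" and "invariant_metric G d" and "proper_metric G T d"
    and "continuous_metric (dual_group G T) (dual_topology G T) d'"
    and "invariant_metric (dual_group G T) d'"
    and "proper_metric (dual_group G T) (dual_topology G T) d'"
    and "t > 0" and "A > 0" and "A' > 0"
    and "polynomial_growth G M d t A"
    and "polynomial_growth (dual_group G T) N d' t A'"
    and "f \<in> L2 M"
  shows "(INF (a, b) \<in> carrier G \<times> carrier (dual_group G T).
            dispersion M d a f * dispersion N d' b (plancherel M N f))
         \<ge> ennreal (alpha t / (A powr (2 / t) * A' powr (2 / t)) * L2_norm M f ^ 4)"
proof -
  interpret lca_group G T by fact
  interpret G: haar_metric_group G T M d t A
    by unfold_locales (use assms topspace_eq_carrier in auto)
  interpret dual: haar_metric_group "dual_group G T" "dual_topology G T" N d' t A'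
    using group_dual_group[OF is_group topspace_eq_carrier] topspace_dual_topology[of G T] assms
    by (intro haar_metric_group.intro haar_metric_group_axioms.intro) auto
  interpret plancherel_pair M N
  proof
    show "plancherel_normalized M N" by fact
  next
    fix \<xi> assume "\<xi> \<in> space N"
    then show "\<xi> \<in> borel_measurable M"
      by (intro haar_measure_continuous_measurable[OF assms(2)])
        (simp add: dual.space_eq carrier_dual_group)
  next
    fix \<xi> x assume "\<xi> \<in> space N" "x \<in> space M"
    then show "norm (\<xi> x) = 1"
      by (simp add: dual.space_eq G.space_eq carrier_dual_group)
  qed
  define F where "F = plancherel M N f"
  define n where "n = (L2_norm M f)\<^sup>2"
  have F: "F \<in> L2 N" "L2_norm N F = L2_norm M f"
    unfolding F_def by (rule plancherel_in_L2[OF normalized assms(16)])+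
  obtain \<delta> where \<delta>: "0 < \<delta>" "\<delta> < 1/2"
    and alpha: "alpha t = (1 - 2 * \<delta>) powr (4 / t) * (2 * \<delta> - \<delta>\<^sup>2) ^ 4"
    using alpha_attained[OF \<open>t > 0\<close>] by blast
  define c where "c = 1 - 2 * \<delta>"
  \<comment> \<open>Chosen so that the growth bounds for radii s and s' with s s' = R multiply to A
    A' R^t = c^2.\<close>
  define R where "R = (c\<^sup>2 / (A * A')) powr (1 / t)"
  have c: "c > 0" using \<delta> by (simp add: c_def)
  have R: "R > 0" using c \<open>A > 0\<close> \<open>A' > 0\<close> by (simp add: R_def)
  have R_powr: "A * A' * R powr t = c\<^sup>2"
    using c \<open>A > 0\<close> \<open>A' > 0\<close> \<open>t > 0\<close> by (simp add: R_def powr_powr)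
  have R_sq: "R\<^sup>2 = c powr (4 / t) / (A powr (2 / t) * A' powr (2 / t))"
  proof -
    have "R\<^sup>2 = (c\<^sup>2 / (A * A')) powr (2 / t)"
      using R by (simp add: R_def powr_powr flip: powr_numeral)
    also have "\<dots> = (c powr 2) powr (2 / t) / (A powr (2 / t) * A' powr (2 / t))"
      using c \<open>A > 0\<close> \<open>A' > 0\<close> by (simp add: powr_divide powr_mult)
    finally show ?thesis by (simp add: powr_powr)
  qed
  have "ennreal (alpha t / (A powr (2 / t) * A' powr (2 / t)) * L2_norm M f ^ 4)
      \<le> dispersion M d a f * dispersion N d' b F"
    if a: "a \<in> carrier G" and b: "b \<in> carrier (dual_group G T)" for a b
  proof (cases "L2_norm M f = 0")
    case True
    then show ?thesis by simp
  next
    case False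
    let ?X = "dispersion M d a f" and ?Y = "dispersion N d' b F"
    have nz: "?X \<noteq> 0" "?Y \<noteq> 0"
      using G.dispersion_eq_0D[OF a assms(16)] dual.dispersion_eq_0D[OF b F(1)] False F(2) by auto
    \<comment> \<open>The concentration bound rewritten for complements: the two outside masses sum
      to at least (1 - c) n, and 1 - c = 2 \<delta>.\<close>
    have mass: "2 * \<delta> * n \<le> G.outside_mass f a s + dual.outside_mass F b s'"
      if s: "s > 0" "s' > 0" "s * s' = R" for s s'
    proof -
      have "measure M (G.dball a s) * measure N (dual.dball b s') \<le> (A * s powr t) * (A' * s' powr t)"
        using G.measure_dball_le(2)[OF a s(1)] dual.measure_dball_le(2)[OF b s(2)] \<open>A > 0\<close>
        by (intro mult_mono) auto
      also have "\<dots> = A * A' * (s * s') powr t"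
        using s(1,2) by (simp add: powr_mult)
      finally have "measure M (G.dball a s) * measure N (dual.dball b s') \<le> c\<^sup>2"
        using R_powr s(3) by simp
      from concentration_uncertainty[OF assms(16) G.sets_dball[OF a] G.measure_dball_le(1)[OF a s(1)]
          dual.sets_dball[OF b] dual.measure_dball_le(1)[OF b s(2)] c this]
      have "(n - G.outside_mass f a s) + (n - dual.outside_mass F b s') \<le> (1 + c) * n"
        unfolding F_def[symmetric] G.inside_mass[OF a assms(16)] dual.inside_mass[OF b F(1)] F(2)
        by (simp add: n_def)
      then show ?thesis by (simp add: c_def algebra_simps)
    qed
    show ?thesis
    proof (cases "?X = \<infinity> \<or> ?Y = \<infinity>")
      case True
      then have "?X * ?Y = \<infinity>"
        using nz by (auto simp: ennreal_mult_eq_top_iff)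
      then show ?thesis by simp
    next
      case False
      then obtain x y where x: "?X = ennreal x" "x \<ge> 0" and y: "?Y = ennreal y" "y \<ge> 0"
        by (cases ?X; cases ?Y) auto
      have "x > 0" "y > 0"
        using nz x y by (auto simp: order_less_le)
      have "(8 / 3 * \<delta> * n * R / 2)\<^sup>2 \<le> x * y"
      proof (rule product_ge_of_scaled_sum_ge[OF \<open>x > 0\<close> \<open>y > 0\<close> _ R])
        show "0 \<le> 8 / 3 * \<delta> * n" using \<delta> by (simp add: n_def)
      next
        fix r r' :: real assume r: "r > 0" "r' > 0" "r * r' = R"
        let ?k = "sqrt (3/2)"
        let ?m1 = "G.outside_mass f a (r / ?k)" and ?m2 = "G.outside_mass f a (r * ?k)"
        let ?m1' = "dual.outside_mass F b (r' / ?k)" and ?m2' = "dual.outside_mass F b (r' * ?k)"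
        \<comment> \<open>The smaller radius on one side is paired with the larger one on the other,
          so both products are R. Adding the two bounds gives 4 \<delta> n, and the Chebyshev factor
          2/3 turns it into (8/3) \<delta> n.\<close>
        have "2 * \<delta> * n \<le> ?m1 + ?m2'" "2 * \<delta> * n \<le> ?m2 + ?m1'"
          using r by (intro mass; simp)+
        moreover have "2 / 3 * (?m1 + ?m2) \<le> x / r\<^sup>2"
          using G.dispersion_ge[OF a assms(16) r(1)] x r(1)
          by (simp add: ennreal_le_iff pos_le_divide_eq algebra_simps)
        moreover have "2 / 3 * (?m1' + ?m2') \<le> y / r'\<^sup>2"
          using dual.dispersion_ge[OF b F(1) r(2)] y r(2)
          by (simp add: ennreal_le_iff pos_le_divide_eq algebra_simps)
        ultimately show "8 / 3 * \<delta> * n \<le> x / r\<^sup>2 + y / r'\<^sup>2"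
          unfolding mult.assoc by argo
      qed
      \<comment> \<open>R^2 supplies both growth constants and the factor c powr (4 / t) of
        \<open>alpha t\<close>, while n^2 is the fourth power of the norm.\<close>
      moreover have "alpha t / (A powr (2 / t) * A' powr (2 / t)) * L2_norm M f ^ 4
          = (2 * \<delta> - \<delta>\<^sup>2) ^ 4 * (n * R)\<^sup>2"
        unfolding alpha power_mult_distrib R_sq c_def n_def by simp
      moreover have "(2 * \<delta> - \<delta>\<^sup>2) ^ 4 * (n * R)\<^sup>2 \<le> (4 / 3 * \<delta>)\<^sup>2 * (n * R)\<^sup>2"
        by (intro mult_right_mono delta_polynomial_le \<delta>) simp
      moreover have "(4 / 3 * \<delta>)\<^sup>2 * (n * R)\<^sup>2 = (8 / 3 * \<delta> * n * R / 2)\<^sup>2"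
        unfolding power_mult_distrib[symmetric] by (simp add: mult_ac)
      ultimately have "alpha t / (A powr (2 / t) * A' powr (2 / t)) * L2_norm M f ^ 4 \<le> x * y"
        by linarith
      then show ?thesis
        unfolding x(1) y(1) using x(2) y(2) by (simp add: ennreal_mult[symmetric] ennreal_leI)
    qed
  qed
  then show ?thesis
    unfolding F_def by (intro INF_greatest) auto
qed

end
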